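(* For any fixed constant $c>1$, any (possibly randomized) algorithm that, given query access to an $n$-vertex graph with maximum degree $\Delta$, outputs a proper $(c\cdot\Delta)$-coloring of the graph with probability at least a sufficiently large constant (e.g., $1-o(1)$) requires $\Omega(n\sqrt{n})$ queries.
   Context: Query model: degree queries (given $v$, return $\deg(v)$), neighbor queries (given $v$ and $i\le\deg(v)$, return the $i$-th neighbor of $v$ in an arbitrary ordering of its adjacency list) and pair queries (given $u,v$, return whether $(u,v)$ is an edge). *)

theory Defs
  imports "HOL-Probability.Probability_Mass_Function"
begin

text \<open>Graphs on the vertex set {0..<n}, given by adjacency lists. The list L v is
  the (arbitrarily ordered) adjacency list of vertex v.\<close>

definition adj_valid :: "nat \<Rightarrow> (nat \<Rightarrow> nat list) \<Rightarrow> bool" where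
  "adj_valid n L \<longleftrightarrow>
     (\<forall>v. n \<le> v \<longrightarrow> L v = []) \<and>
     (\<forall>v<n. distinct (L v) \<and> (\<forall>u\<in>set (L v). u < n \<and> u \<noteq> v \<and> v \<in> set (L u)))"

definition max_deg :: "nat \<Rightarrow> (nat \<Rightarrow> nat list) \<Rightarrow> nat" where
  "max_deg n L = Max (insert 0 ((\<lambda>v. length (L v)) ` {..<n}))"

datatype query = DegQ nat | NbrQ nat nat | PairQ nat nat

fun answer :: "(nat \<Rightarrow> nat list) \<Rightarrow> query \<Rightarrow> nat option" where
  "answer L (DegQ v) = Some (length (L v))"
| "answer L (NbrQ v i) = (if i < length (L v) then Some (L v ! i) else None)"
| "answer L (PairQ u v) = Some (if v \<in> set (L u) then 1 else 0)"

text \<open>Deterministic adaptive query algorithms = decision trees; alg_output a colouring.\<close>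
datatype 'o dtree = Leaf 'o | Ask query "nat option \<Rightarrow> 'o dtree"

primrec run :: "'o dtree \<Rightarrow> (nat \<Rightarrow> nat list) \<Rightarrow> 'o \<times> nat" where
  "run (Leaf x) L = (x, 0)"
| "run (Ask q f) L = (let r = run (f (answer L q)) L in (fst r, Suc (snd r)))"

definition alg_output :: "'o dtree \<Rightarrow> (nat \<Rightarrow> nat list) \<Rightarrow> 'o" where
  "alg_output T L = fst (run T L)"

definition num_queries :: "'o dtree \<Rightarrow> (nat \<Rightarrow> nat list) \<Rightarrow> nat" where
  "num_queries T L = snd (run T L)"

definition proper_coloring :: "nat \<Rightarrow> (nat \<Rightarrow> nat list) \<Rightarrow> (nat \<Rightarrow> nat) \<Rightarrow> real \<Rightarrow> bool" where
  "proper_coloring n L col k \<longleftrightarrow>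
     (\<forall>v<n. real (col v) < k) \<and> (\<forall>v<n. \<forall>u\<in>set (L v). col u \<noteq> col v)"

type_synonym ralg = "(nat \<Rightarrow> nat) dtree pmf"

end

(* Fix the degree sequence of disjoint (D+1)-cliques, with D of order sqrt (n / c), and let the
   input be uniform among all adjacency lists with these degrees. If a decision tree outputs a
   proper colouring on L, pick edges ab and xy of L with a and x of the same colour and replace
   them by ax and by, in place. If the run on L never touched any of these four pairs, it repeats
   itself on the new input, where the edge ax is now monochromatic. Cauchy-Schwarz over the colour
   classes of the untouched arcs shows that each success admits of order n^2 D / c such switches,
   provided that there are few queries; a failure arises from at most 4 n D of them, because its
   only monochromatic arcs are ax, xa and possibly by, yb. Hence at most half of the inputs are
   successes, and averaging over the random tree gives a bad input. *)

theory Submission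
  imports Defs
begin

section \<open>Edge switches on adjacency lists\<close>

definition arcs :: "(nat \<Rightarrow> nat list) \<Rightarrow> (nat \<times> nat) set" where
  "arcs L = {(u, v). v \<in> set (L u)}"

text \<open>Entries are replaced at their own positions, so degrees and all other list positions are
  kept, and only queries about the pairs involved can notice the change.\<close>

definition switch :: "nat \<Rightarrow> nat \<Rightarrow> nat \<Rightarrow> nat \<Rightarrow> (nat \<Rightarrow> nat list) \<Rightarrow> nat \<Rightarrow> nat list" where
  "switch a b x y L = (\<lambda>v. map (\<lambda>u.
     if v = a \<and> u = b then x else if v = b \<and> u = a then y
     else if v = x \<and> u = y then a else if v = y \<and> u = x then b else u) (L v))"

text \<open>The non-arc conditions rule out multiple edges after the switch, the inequalities rule
  out loops.\<close>

definition switchable :: "(nat \<Rightarrow> nat list) \<Rightarrow> nat \<Rightarrow> nat \<Rightarrow> nat \<Rightarrow> nat \<Rightarrow> bool" where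
  "switchable L a b x y \<longleftrightarrow> (a, b) \<in> arcs L \<and> (x, y) \<in> arcs L \<and>
     (a, x) \<notin> arcs L \<and> (b, y) \<notin> arcs L \<and> a \<noteq> x \<and> b \<noteq> y"

lemma adj_valid_sym: "adj_valid n L \<Longrightarrow> (u, v) \<in> arcs L \<Longrightarrow> (v, u) \<in> arcs L"
  unfolding adj_valid_def arcs_def
  by (metis case_prodD case_prodI mem_Collect_eq emptyE empty_set not_le)

lemma adj_valid_irrefl: "adj_valid n L \<Longrightarrow> (u, u) \<notin> arcs L"
  unfolding adj_valid_def arcs_def
  by (metis case_prodD mem_Collect_eq emptyE empty_set not_le)

lemma adj_valid_bound: "adj_valid n L \<Longrightarrow> (u, v) \<in> arcs L \<Longrightarrow> u < n \<and> v < n"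
  unfolding adj_valid_def arcs_def
  by (metis case_prodD mem_Collect_eq emptyE empty_set not_le)

lemma adj_valid_distinct: "adj_valid n L \<Longrightarrow> distinct (L v)"
  unfolding adj_valid_def by (cases "v < n") auto

lemma adj_validI:
  assumes "\<And>v. distinct (L v)" "\<And>u v. (u, v) \<in> arcs L \<Longrightarrow> u < n \<and> u \<noteq> v \<and> (v, u) \<in> arcs L"
  shows "adj_valid n L"
proof -
  have "L v = []" if "n \<le> v" for v
    using assms(2)[of v] that unfolding arcs_def by (cases "L v") force+
  then show ?thesis
    using assms unfolding adj_valid_def arcs_def by blast
qed

text \<open>If \<open>b = x\<close>, then \<open>(a, x)\<close> is the arc \<open>(a, b)\<close>; if
  \<open>a = y\<close>, it is the reverse of the arc \<open>(x, y)\<close>. Both are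
  excluded.\<close>

lemma switchable_distinct:
  assumes "adj_valid n L" "switchable L a b x y"
  shows "distinct [a, b, x, y]"
  using assms adj_valid_sym[OF assms(1)] adj_valid_irrefl[OF assms(1)]
  unfolding switchable_def by auto

lemma length_switch [simp]: "length (switch a b x y L v) = length (L v)"
  by (simp add: switch_def)

lemma arcs_switch:
  assumes "adj_valid n L" "switchable L a b x y"
  shows "arcs (switch a b x y L) =
    (arcs L - {(a, b), (b, a), (x, y), (y, x)}) \<union> {(a, x), (x, a), (b, y), (y, b)}"
proof -
  note d = switchable_distinct[OF assms]
  have e: "(a, b) \<in> arcs L" "(b, a) \<in> arcs L" "(x, y) \<in> arcs L" "(y, x) \<in> arcs L"
    using assms adj_valid_sym unfolding switchable_def by blast+
  show ?thesis
  proof (intro set_eqI)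
    fix p :: "nat \<times> nat"
    obtain v w where p: "p = (v, w)" by force
    show "p \<in> arcs (switch a b x y L) \<longleftrightarrow>
      p \<in> (arcs L - {(a, b), (b, a), (x, y), (y, x)}) \<union> {(a, x), (x, a), (b, y), (y, b)}"
      using d e unfolding p arcs_def switch_def
      by (cases "v = a"; cases "v = b"; cases "v = x"; cases "v = y") (auto simp: image_iff)
  qed
qed

lemma distinct_switch:
  assumes "adj_valid n L" "switchable L a b x y"
  shows "distinct (switch a b x y L v)"
proof -
  note d = switchable_distinct[OF assms]
  have e: "(a, x) \<notin> arcs L" "(x, a) \<notin> arcs L" "(b, y) \<notin> arcs L" "(y, b) \<notin> arcs L"
    using assms adj_valid_sym unfolding switchable_def by blast+
  \<comment> \<open>In each of the four affected lists a single entry changes, and its new value did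
    not occur in that list.\<close>
  have "inj_on (\<lambda>u. if v = a \<and> u = b then x else if v = b \<and> u = a then y
     else if v = x \<and> u = y then a else if v = y \<and> u = x then b else u) (set (L v))"
    using d e unfolding arcs_def inj_on_def by auto
  then show ?thesis
    unfolding switch_def by (simp add: distinct_map adj_valid_distinct[OF assms(1)])
qed

lemma adj_valid_switch:
  assumes "adj_valid n L" "switchable L a b x y"
  shows "adj_valid n (switch a b x y L)"
proof (rule adj_validI)
  show "distinct (switch a b x y L v)" for v by (rule distinct_switch[OF assms])
next
  fix u v assume h: "(u, v) \<in> arcs (switch a b x y L)"
  have "a < n" "b < n" "x < n" "y < n"
    using assms adj_valid_bound unfolding switchable_def by blast+
  moreover have "(u, v) \<in> arcs L \<Longrightarrow> u < n \<and> u \<noteq> v \<and> (v, u) \<in> arcs L"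
    using adj_valid_sym[OF assms(1)] adj_valid_irrefl[OF assms(1)] adj_valid_bound[OF assms(1)] by blast
  ultimately show "u < n \<and> u \<noteq> v \<and> (v, u) \<in> arcs (switch a b x y L)"
    using h switchable_distinct[OF assms] unfolding arcs_switch[OF assms] by auto
qed

text \<open>The inverse of a switch is the switch with \<open>b\<close> and \<open>x\<close>
  exchanged: since \<open>ax\<close> and \<open>by\<close> were not edges, it moves back exactly the
  new entries. This makes the later counting map injective.\<close>

lemma switch_switch:
  assumes "adj_valid n L" "switchable L a b x y"
  shows "switch a x b y (switch a b x y L) = L"
proof
  fix v
  note d = switchable_distinct[OF assms]
  have e: "(a, x) \<notin> arcs L" "(x, a) \<notin> arcs L" "(b, y) \<notin> arcs L" "(y, b) \<notin> arcs L"
    using assms adj_valid_sym unfolding switchable_def by blast+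
  show "switch a x b y (switch a b x y L) v = L v"
    unfolding switch_def map_map
    using d e by (intro map_idI) (auto simp: arcs_def)
qed

section \<open>Query transcripts and the pairs they touch\<close>

primrec asked :: "'o dtree \<Rightarrow> (nat \<Rightarrow> nat list) \<Rightarrow> query list" where
  "asked (Leaf x) L = []"
| "asked (Ask q f) L = q # asked (f (answer L q)) L"

lemma length_asked: "length (asked T L) = num_queries T L"
  by (induction T) (auto simp: num_queries_def Let_def)

text \<open>Agreement on the path of \<open>L\<close> suffices, because equal answers keep
  \<open>L'\<close> on that path.\<close>

lemma run_cong:
  "(\<And>q. q \<in> set (asked T L) \<Longrightarrow> answer L' q = answer L q) \<Longrightarrow> run T L' = run T L"
  by (induction T) (auto simp: Let_def)

text \<open>An index beyond the length of the list makes the touched pair junk; this is harmless, since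
  it only adds a pair to the small set of seen ones.\<close>

fun touch :: "(nat \<Rightarrow> nat list) \<Rightarrow> query \<Rightarrow> nat \<times> nat" where
  "touch L (DegQ v) = (v, v)"
| "touch L (NbrQ v i) = (v, L v ! i)"
| "touch L (PairQ u v) = (u, v)"

text \<open>Closed under reversal, so that one membership test covers both orientations of a pair;
  this costs the factor 2 in \<open>card_seen\<close>.\<close>

definition seen :: "'o dtree \<Rightarrow> (nat \<Rightarrow> nat list) \<Rightarrow> (nat \<times> nat) set" where
  "seen T L = touch L ` set (asked T L) \<union> (touch L ` set (asked T L))\<inverse>"

lemma finite_seen: "finite (seen T L)"
  by (simp add: seen_def)

lemma card_seen: "card (seen T L) \<le> 2 * num_queries T L"
proof -
  have "card (touch L ` set (asked T L)) \<le> num_queries T L"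
    by (metis card_image_le card_length finite_set le_trans length_asked)
  then show ?thesis
    unfolding seen_def using card_Un_le[of "touch L ` set (asked T L)" "(touch L ` set (asked T L))\<inverse>"]
    by (simp add: card_inverse)
qed

text \<open>Degrees are kept, a neighbor query changes its answer only if it reads one of the
  removed edges, and a pair query only if it asks for a removed or an added one.\<close>

lemma run_switch:
  assumes "adj_valid n L" "switchable L a b x y"
    and unseen: "(a, b) \<notin> seen T L" "(x, y) \<notin> seen T L" "(a, x) \<notin> seen T L" "(b, y) \<notin> seen T L"
  shows "run T (switch a b x y L) = run T L"
proof (rule run_cong)
  fix q assume q: "q \<in> set (asked T L)"
  have t: "touch L q \<notin> {(a, b), (b, a), (x, y), (y, x), (a, x), (x, a), (b, y), (y, b)}"
    using unseen q unfolding seen_def by (auto simp: image_iff)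
  show "answer (switch a b x y L) q = answer L q"
  proof (cases q)
    case (DegQ v)
    then show ?thesis by simp
  next
    case (NbrQ v i)
    with t show ?thesis by (auto simp: switch_def)
  next
    case (PairQ u v)
    have "(u, v) \<in> arcs (switch a b x y L) \<longleftrightarrow> (u, v) \<in> arcs L"
      using t PairQ unfolding arcs_switch[OF assms(1,2)] by auto
    with PairQ show ?thesis by (simp add: arcs_def)
  qed
qed

section \<open>Counting arcs and pairs of arcs\<close>

lemma arcs_Sigma: "adj_valid n L \<Longrightarrow> arcs L = (SIGMA v:{..<n}. set (L v))"
  using adj_valid_bound by (force simp: arcs_def)

lemma finite_arcs: "adj_valid n L \<Longrightarrow> finite (arcs L)"
  by (simp add: arcs_Sigma)

lemma card_arcs: "adj_valid n L \<Longrightarrow> card (arcs L) = (\<Sum>v<n. length (L v))"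
  by (simp add: arcs_Sigma distinct_card adj_valid_distinct)

lemma card_arcs_le:
  assumes "adj_valid n L" "\<And>v. length (L v) \<le> D"
  shows "card (arcs L) \<le> n * D"
  using sum_bounded_above[of "{..<n}" "\<lambda>v. length (L v)" D] assms by (simp add: card_arcs)

text \<open>Once the tails \<open>(a, x)\<close> are chosen in \<open>R\<close>, each head has at
  most \<open>D\<close> choices. With \<open>R\<close> a set of forbidden pairs, this bounds the arc
  pairs that cannot be switched.\<close>

lemma arc_pairs_at_tails:
  assumes "finite R" and "\<And>v. length (L v) \<le> D"
  shows "finite {(a, b, x, y). (a, b) \<in> arcs L \<and> (x, y) \<in> arcs L \<and> (a, x) \<in> R}"
    and "card {(a, b, x, y). (a, b) \<in> arcs L \<and> (x, y) \<in> arcs L \<and> (a, x) \<in> R} \<le> card R * D\<^sup>2"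
proof -
  let ?S = "SIGMA p:R. set (L (fst p)) \<times> set (L (snd p))"
  have eq: "{(a, b, x, y). (a, b) \<in> arcs L \<and> (x, y) \<in> arcs L \<and> (a, x) \<in> R}
      = (\<lambda>((a, x), b, y). (a, b, x, y)) ` ?S"
    by (force simp: arcs_def)
  have fin: "finite ?S" using assms by auto
  then show "finite {(a, b, x, y). (a, b) \<in> arcs L \<and> (x, y) \<in> arcs L \<and> (a, x) \<in> R}"
    unfolding eq by blast
  have "card ?S = (\<Sum>p\<in>R. card (set (L (fst p))) * card (set (L (snd p))))"
    using assms by (simp add: card_cartesian_product)
  also have "\<dots> \<le> (\<Sum>p\<in>R. D * D)"
    by (intro sum_mono mult_le_mono order.trans[OF card_length] assms(2))
  finally have "card ?S \<le> card R * D\<^sup>2" by (simp add: power2_eq_square)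
  then show "card {(a, b, x, y). (a, b) \<in> arcs L \<and> (x, y) \<in> arcs L \<and> (a, x) \<in> R} \<le> card R * D\<^sup>2"
    unfolding eq using card_image_le[OF fin] order.trans by blast
qed

lemma arc_pairs_at_heads:
  assumes "adj_valid n L" "finite R" and "\<And>v. length (L v) \<le> D"
  shows "finite {(a, b, x, y). (a, b) \<in> arcs L \<and> (x, y) \<in> arcs L \<and> (b, y) \<in> R}"
    and "card {(a, b, x, y). (a, b) \<in> arcs L \<and> (x, y) \<in> arcs L \<and> (b, y) \<in> R} \<le> card R * D\<^sup>2"
proof -
  let ?S = "{(a, b, x, y). (a, b) \<in> arcs L \<and> (x, y) \<in> arcs L \<and> (a, x) \<in> R}"
  \<comment> \<open>Reversing both arcs exchanges heads and tails.\<close>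
  have eq: "{(a, b, x, y). (a, b) \<in> arcs L \<and> (x, y) \<in> arcs L \<and> (b, y) \<in> R}
      = (\<lambda>(a, b, x, y). (b, a, y, x)) ` ?S"
    using adj_valid_sym[OF assms(1)] by (auto simp: image_iff)
  note S = arc_pairs_at_tails[where L = L, OF assms(2,3)]
  show "finite {(a, b, x, y). (a, b) \<in> arcs L \<and> (x, y) \<in> arcs L \<and> (b, y) \<in> R}"
    unfolding eq using S(1) by blast
  show "card {(a, b, x, y). (a, b) \<in> arcs L \<and> (x, y) \<in> arcs L \<and> (b, y) \<in> R} \<le> card R * D\<^sup>2"
    unfolding eq using card_image_le[OF S(1)] S(2) order.trans by blast
qed

text \<open>Group the arcs by the colour of the tail: a class of size m yields m^2 ordered pairs,
  and Cauchy-Schwarz over the \<open>K\<close> classes bounds the sum of these squares from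
  below.\<close>

lemma monochromatic_pairs_lower_bound:
  fixes col :: "nat \<Rightarrow> nat"
  assumes "finite A" and "\<And>a b. (a, b) \<in> A \<Longrightarrow> col a < K"
  shows "(card A)\<^sup>2 \<le> K * card {(a, b, x, y). (a, b) \<in> A \<and> (x, y) \<in> A \<and> col a = col x}"
proof -
  let ?C = "\<lambda>k. {p \<in> A. col (fst p) = k}"
  let ?M = "{(a, b, x, y). (a, b) \<in> A \<and> (x, y) \<in> A \<and> col a = col x}"
  have "finite ((\<lambda>((a, b), x, y). (a, b, x, y)) ` (A \<times> A))" using assms(1) by blast
  then have "finite ?M" by (rule rev_finite_subset) (force simp: image_iff)
  then have "card (SIGMA k:{..<K}. ?C k \<times> ?C k) \<le> card ?M"
    by (intro card_inj_on_le[where f = "\<lambda>(k, (a, b), x, y). (a, b, x, y)"])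
       (auto simp: inj_on_def)
  then have M: "(\<Sum>k<K. (card (?C k))\<^sup>2) \<le> card ?M"
    using assms(1) by (simp add: card_cartesian_product power2_eq_square)
  have "(\<Sum>k<K. \<Sum>p\<in>?C k. 1) = (\<Sum>p\<in>A. 1::nat)"
    using assms by (intro sum.group) auto
  then have "card A = (\<Sum>k<K. card (?C k))" by simp
  then have "(real (card A))\<^sup>2 \<le> real K * (\<Sum>k<K. (real (card (?C k)))\<^sup>2)"
    using sum_squared_le_sum_of_squares[of "\<lambda>k. real (card (?C k))" "{..<K}"]
    by (simp add: mult.commute)
  then have "real ((card A)\<^sup>2) \<le> real (K * (\<Sum>k<K. (card (?C k))\<^sup>2))" by simp
  then have "(card A)\<^sup>2 \<le> K * (\<Sum>k<K. (card (?C k))\<^sup>2)" by (simp only: of_nat_le_iff)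
  also have "\<dots> \<le> K * card ?M" using M by simp
  finally show ?thesis .
qed

section \<open>Switches that a run cannot notice\<close>

text \<open>For successful \<open>L\<close> these are the edges of a bipartite graph between
  successes and failures, to be counted from both sides.\<close>

definition hidden_switches :: "(nat \<Rightarrow> nat) dtree \<Rightarrow> (nat \<Rightarrow> nat list) \<Rightarrow> (nat \<times> nat \<times> nat \<times> nat) set" where
  "hidden_switches T L = {(a, b, x, y). switchable L a b x y \<and> alg_output T L a = alg_output T L x \<and>
     (a, b) \<notin> seen T L \<and> (x, y) \<notin> seen T L \<and> (a, x) \<notin> seen T L \<and> (b, y) \<notin> seen T L}"

lemma finite_hidden_switches:
  assumes "adj_valid n L"
  shows "finite (hidden_switches T L)"
proof (rule finite_subset)
  show "hidden_switches T L \<subseteq> (\<lambda>((a, b), x, y). (a, b, x, y)) ` (arcs L \<times> arcs L)"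
    by (force simp: hidden_switches_def switchable_def image_iff)
qed (use finite_arcs[OF assms] in blast)

lemma proper_coloring_arc:
  "adj_valid n L \<Longrightarrow> proper_coloring n L col k \<Longrightarrow> (u, v) \<in> arcs L \<Longrightarrow> col u \<noteq> col v"
  using adj_valid_bound[of n L u v] unfolding proper_coloring_def arcs_def
  by (metis (no_types, lifting) case_prodD mem_Collect_eq)

text \<open>Almost all monochromatic pairs of unseen arcs are hidden switches. The exceptions have a
  forbidden pair of tails, \<open>?B1\<close>, or of heads, \<open>?B2\<close>, and their number is
  the error term.\<close>

lemma hidden_switches_lower_bound:
  assumes valid: "adj_valid n L" and deg: "\<And>v. length (L v) \<le> D"
    and proper: "proper_coloring n L (alg_output T L) k" and k: "k \<le> real K"
    and q: "num_queries T L \<le> q"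
  shows "(card (arcs L) - 2 * q)\<^sup>2 \<le> K * (card (hidden_switches T L) + (2 * n + 4 * q + n * D) * D\<^sup>2)"
proof -
  let ?A = "arcs L - seen T L"
  let ?col = "alg_output T L"
  let ?M = "{(a, b, x, y). (a, b) \<in> ?A \<and> (x, y) \<in> ?A \<and> ?col a = ?col x}"
  let ?R = "Id_on {..<n} \<union> seen T L"
  let ?B1 = "{(a, b, x, y). (a, b) \<in> arcs L \<and> (x, y) \<in> arcs L \<and> (a, x) \<in> ?R}"
  let ?B2 = "{(a, b, x, y). (a, b) \<in> arcs L \<and> (x, y) \<in> arcs L \<and> (b, y) \<in> ?R \<union> arcs L}"
  note fin = finite_arcs[OF valid] finite_seen[of T L]
  have finI: "finite (Id_on {..<n})" by (simp add: Id_on_def)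
  have "card (Id_on {..<n}) = n"
    by (simp add: Id_on_def card_UN_disjoint)
  then have R: "card ?R \<le> n + 2 * q"
    using card_Un_le[of "Id_on {..<n}" "seen T L"] card_seen[of T L] q by linarith
  then have R': "card (?R \<union> arcs L) \<le> n + 2 * q + n * D"
    using card_Un_le[of ?R "arcs L"] card_arcs_le[OF valid deg] by linarith
  have f1: "finite ?B1" and f2: "finite ?B2"
    using arc_pairs_at_tails(1)[of ?R L D] arc_pairs_at_heads(1)[of n L "?R \<union> arcs L" D] valid deg fin finI
    by blast+
  have "card ?B1 \<le> card ?R * D\<^sup>2"
    using arc_pairs_at_tails(2)[of ?R L D] deg fin finI by blast
  then have B1: "card ?B1 \<le> (n + 2 * q) * D\<^sup>2"
    using R by (meson mult_le_mono1 order.trans)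
  have "card ?B2 \<le> card (?R \<union> arcs L) * D\<^sup>2"
    using arc_pairs_at_heads(2)[of n L "?R \<union> arcs L" D] valid deg fin finI by blast
  then have B2: "card ?B2 \<le> (n + 2 * q + n * D) * D\<^sup>2"
    using R' by (meson mult_le_mono1 order.trans)
  \<comment> \<open>Tails of equal colour are never adjacent, as the colouring is proper; so
    adjacency has to be excluded for the heads only, which is why \<open>arcs L\<close> enters
    \<open>?B2\<close> but not \<open>?B1\<close>.\<close>
  have "?M \<subseteq> hidden_switches T L \<union> ?B1 \<union> ?B2"
    using proper_coloring_arc[OF valid proper] adj_valid_bound[OF valid]
    unfolding hidden_switches_def switchable_def by auto
  then have "card ?M \<le> card (hidden_switches T L \<union> ?B1 \<union> ?B2)"
    by (intro card_mono) (use f1 f2 finite_hidden_switches[OF valid] in blast)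
  also have "\<dots> \<le> card (hidden_switches T L) + card ?B1 + card ?B2"
    by (meson card_Un_le add_le_mono1 order.trans)
  finally have M: "card ?M \<le> card (hidden_switches T L) + (2 * n + 4 * q + n * D) * D\<^sup>2"
    using B1 B2 by (simp add: algebra_simps)
  have "?col a < K" if "(a, b) \<in> ?A" for a b
  proof -
    have "real (?col a) < k"
      using that adj_valid_bound[OF valid] proper unfolding proper_coloring_def by blast
    with k show ?thesis by linarith
  qed
  then have "(card ?A)\<^sup>2 \<le> K * card ?M"
    using fin by (intro monochromatic_pairs_lower_bound) auto
  moreover have "card (arcs L) - 2 * q \<le> card ?A"
    using diff_card_le_card_Diff[OF fin(2), of "arcs L"] card_seen[of T L] q by linarith
  ultimately show ?thesis
    using M by (meson mult_le_mono2 order.trans power_mono zero_le)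
qed

text \<open>The run repeats itself on \<open>L'\<close>, so the output is still the colouring that
  is proper for \<open>L\<close>, and only the added arcs can be monochromatic.\<close>

lemma switch_monochromatic_arcs:
  assumes "adj_valid n L" "proper_coloring n L (alg_output T L) k" "(a, b, x, y) \<in> hidden_switches T L"
  defines "L' \<equiv> switch a b x y L"
  defines "M \<equiv> {(u, v) \<in> arcs L'. alg_output T L' u = alg_output T L' v}"
  shows "(a, x) \<in> M" "M \<subseteq> {(a, x), (x, a), (b, y), (y, b)}" "(b, y) \<in> arcs L'"
proof -
  have s: "switchable L a b x y" using assms(3) by (simp add: hidden_switches_def)
  have "run T L' = run T L"
    using assms(1,3) run_switch unfolding hidden_switches_def L'_def by blast
  then have o: "alg_output T L' = alg_output T L" by (simp add: alg_output_def)
  show "(b, y) \<in> arcs L'" by (simp add: L'_def arcs_switch[OF assms(1) s])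
  show "(a, x) \<in> M"
    using assms(3) unfolding M_def o unfolding L'_def arcs_switch[OF assms(1) s]
    by (simp add: hidden_switches_def)
  show "M \<subseteq> {(a, x), (x, a), (b, y), (y, b)}"
    using proper_coloring_arc[OF assms(1,2)] unfolding M_def o
    unfolding L'_def arcs_switch[OF assms(1) s] by auto
qed

text \<open>A switch leading to \<open>L'\<close> is determined by \<open>(a, x)\<close>, one of at
  most four monochromatic arcs of \<open>L'\<close>, and by \<open>(b, y)\<close>, one of at most
  \<open>n * D\<close> arcs.\<close>

lemma card_switch_preimages:
  fixes T k
  assumes "adj_valid n L'" "\<And>v. length (L' v) \<le> D"
  defines "P \<equiv> {(a, b, x, y). \<exists>L. adj_valid n L \<and> proper_coloring n L (alg_output T L) k \<and>
      (a, b, x, y) \<in> hidden_switches T L \<and> L' = switch a b x y L}"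
  shows "finite P" "card P \<le> 4 * (n * D)"
proof -
  let ?M = "{(u, v) \<in> arcs L'. alg_output T L' u = alg_output T L' v}"
  have "finite P \<and> card P \<le> 4 * (n * D)"
  proof (cases "P = {}")
    case False
    \<comment> \<open>The set \<open>?M\<close> depends on \<open>L'\<close> alone, so a single
      preimage is enough to bound it for all of them.\<close>
    then obtain a b x y L where L: "adj_valid n L" "proper_coloring n L (alg_output T L) k"
      "(a, b, x, y) \<in> hidden_switches T L" "L' = switch a b x y L"
      unfolding P_def by blast
    then have "?M \<subseteq> {(a, x), (x, a), (b, y), (y, b)}"
      using switch_monochromatic_arcs(2)[OF L(1-3)] by simp
    then have "card ?M \<le> card {(a, x), (x, a), (b, y), (y, b)}" by (intro card_mono) auto
    also have "\<dots> \<le> 4"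
      using card_length[of "[(a, x), (x, a), (b, y), (y, b)]"] by simp
    finally have M: "card ?M \<le> 4" .
    have fM: "finite ?M" using finite_arcs[OF assms(1)] by (rule rev_finite_subset) auto
    have sub: "P \<subseteq> (\<lambda>((a, x), b, y). (a, b, x, y)) ` (?M \<times> arcs L')"
    proof
      fix p assume p: "p \<in> P"
      then obtain a b x y L where L: "adj_valid n L" "proper_coloring n L (alg_output T L) k"
        "(a, b, x, y) \<in> hidden_switches T L" "L' = switch a b x y L" and p_eq: "p = (a, b, x, y)"
        unfolding P_def by blast
      then have "(a, x) \<in> ?M" "(b, y) \<in> arcs L'"
        using switch_monochromatic_arcs(1,3)[OF L(1-3)] by simp_all
      with p_eq show "p \<in> (\<lambda>((a, x), b, y). (a, b, x, y)) ` (?M \<times> arcs L')"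
        by (intro image_eqI[of _ _ "((a, x), b, y)"]) auto
    qed
    have fin: "finite (?M \<times> arcs L')" using fM finite_arcs[OF assms(1)] by blast
    have "card P \<le> card (?M \<times> arcs L')"
      by (rule surj_card_le[OF fin sub])
    also have "\<dots> \<le> 4 * (n * D)"
      unfolding card_cartesian_product
      by (intro mult_le_mono M card_arcs_le[OF assms(1,2)])
    finally show ?thesis using sub fin finite_surj by blast
  qed simp
  then show "finite P" "card P \<le> 4 * (n * D)" by auto
qed

section \<open>Double counting over a fixed degree sequence\<close>

text \<open>Fixing every degree makes the set closed under switches. Different orderings of the
  lists are different inputs.\<close>

definition graphs :: "nat \<Rightarrow> (nat \<Rightarrow> nat) \<Rightarrow> (nat \<Rightarrow> nat list) set" where
  "graphs n d = {L. adj_valid n L \<and> (\<forall>v. length (L v) = d v)}"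

lemma finite_graphs: "finite (graphs n d)"
proof (rule finite_subset)
  let ?B = "{xs :: nat list. set xs \<subseteq> {..<n} \<and> length xs \<le> n}"
  show "graphs n d \<subseteq> {L. \<forall>v. (v \<in> {..<n} \<longrightarrow> L v \<in> ?B) \<and> (v \<notin> {..<n} \<longrightarrow> L v = [])}"
  proof
    fix L assume "L \<in> graphs n d"
    then have valid: "adj_valid n L" by (simp add: graphs_def)
    have sub: "set (L v) \<subseteq> {..<n}" for v
      using adj_valid_bound[OF valid] by (auto simp: arcs_def)
    then have "length (L v) \<le> n" for v
      using card_mono[OF _ sub, of v] by (simp add: distinct_card adj_valid_distinct[OF valid])
    with sub show "L \<in> {L. \<forall>v. (v \<in> {..<n} \<longrightarrow> L v \<in> ?B) \<and> (v \<notin> {..<n} \<longrightarrow> L v = [])}"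
      using valid by (simp add: adj_valid_def)
  qed
  show "finite {L. \<forall>v. (v \<in> {..<n} \<longrightarrow> L v \<in> ?B) \<and> (v \<notin> {..<n} \<longrightarrow> L v = [])}"
    by (intro finite_set_of_finite_funs finite_lists_length_le) auto
qed

text \<open>Count the pairs of a success and a hidden switch of it: each success has at least
  \<open>X\<close> of them, and each failure arises from at most \<open>4 * (n * D)\<close>.\<close>

lemma success_card_bound:
  fixes n k T d
  defines "S \<equiv> {L \<in> graphs n d. proper_coloring n L (alg_output T L) k}"
  assumes deg: "\<And>v. d v \<le> D" and X: "\<And>L. L \<in> S \<Longrightarrow> X \<le> card (hidden_switches T L)"
  shows "card S * X \<le> card (graphs n d - S) * (4 * (n * D))"
proof -
  let ?P = "\<lambda>L'. {(a, b, x, y). \<exists>L. adj_valid n L \<and> proper_coloring n L (alg_output T L) k \<and>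
      (a, b, x, y) \<in> hidden_switches T L \<and> L' = switch a b x y L}"
  let ?f = "\<lambda>(L, a, b, x, y). (switch a b x y L, a, b, x, y)"
  have finS: "finite S" "finite (graphs n d - S)"
    by (auto simp: S_def finite_graphs)
  have S: "adj_valid n L" "proper_coloring n L (alg_output T L) k" "\<And>v. length (L v) = d v" if "L \<in> S" for L
    using that by (auto simp: S_def graphs_def)
  have P: "finite (?P L')" "card (?P L') \<le> 4 * (n * D)" if "L' \<in> graphs n d - S" for L'
    using that deg card_switch_preimages[of n L' D T k] by (auto simp: graphs_def)
  have "card S * X \<le> (\<Sum>L\<in>S. card (hidden_switches T L))"
    using sum_bounded_below[of S X "\<lambda>L. card (hidden_switches T L)"] X by simp
  also have "\<dots> = card (SIGMA L:S. hidden_switches T L)"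
    using finS finite_hidden_switches S by (subst card_SigmaI) auto
  also have "\<dots> \<le> card (SIGMA L':graphs n d - S. ?P L')"
  proof (rule card_inj_on_le[where f = ?f])
    show "inj_on ?f (SIGMA L:S. hidden_switches T L)"
      \<comment> \<open>The image retains the four vertices, so the reverse switch recovers
        \<open>L\<close>.\<close>
      by (rule inj_on_inverseI[where g = "\<lambda>(L, a, b, x, y). (switch a x b y L, a, b, x, y)"])
         (auto simp: hidden_switches_def intro!: switch_switch S(1))
    show "?f ` (SIGMA L:S. hidden_switches T L) \<subseteq> (SIGMA L':graphs n d - S. ?P L')"
    proof safe
      fix L a b x y assume L: "L \<in> S" and h: "(a, b, x, y) \<in> hidden_switches T L"
      let ?L' = "switch a b x y L"
      have valid: "adj_valid n ?L'"
        using h S(1)[OF L] by (auto simp: hidden_switches_def intro: adj_valid_switch)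
      then show "?L' \<in> graphs n d" using S(3)[OF L] by (simp add: graphs_def)
      \<comment> \<open>The arc \<open>(a, x)\<close> of the switched graph is monochromatic under
        the output.\<close>
      show False if "?L' \<in> S"
        using switch_monochromatic_arcs(1)[OF S(1,2)[OF L] h] proper_coloring_arc[OF S(1,2)[OF that]] by blast
      show "\<exists>L0. adj_valid n L0 \<and> proper_coloring n L0 (alg_output T L0) k \<and>
          (a, b, x, y) \<in> hidden_switches T L0 \<and> ?L' = switch a b x y L0"
        using S(1,2)[OF L] h by blast
    qed
    show "finite (SIGMA L':graphs n d - S. ?P L')"
      using finS(2) P(1) by (rule finite_SigmaI)
  qed
  also have "\<dots> = (\<Sum>L'\<in>graphs n d - S. card (?P L'))"
    using finS P(1) by (subst card_SigmaI) auto
  also have "\<dots> \<le> card (graphs n d - S) * (4 * (n * D))"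
    using sum_bounded_above[of "graphs n d - S" "\<lambda>L'. card (?P L')" "4 * (n * D)"] P(2) by simp
  finally show ?thesis .
qed

section \<open>The degree sequence of disjoint cliques\<close>

text \<open>The cliques are the consecutive blocks of \<open>s\<close> vertices, the last one
  possibly cut off at \<open>n\<close>. This graph shows that its degree sequence is
  realisable.\<close>

definition cliques :: "nat \<Rightarrow> nat \<Rightarrow> nat \<Rightarrow> nat list" where
  "cliques n s v = (if v < n then filter (\<lambda>u. u \<noteq> v \<and> u div s = v div s) [0..<n] else [])"

lemma arcs_cliques: "(u, v) \<in> arcs (cliques n s) \<longleftrightarrow> u < n \<and> v < n \<and> u \<noteq> v \<and> u div s = v div s"
  by (auto simp: arcs_def cliques_def)

lemma adj_valid_cliques: "adj_valid n (cliques n s)"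
proof (rule adj_validI)
  show "distinct (cliques n s v)" for v by (simp add: cliques_def)
next
  fix u v assume "(u, v) \<in> arcs (cliques n s)"
  then show "u < n \<and> u \<noteq> v \<and> (v, u) \<in> arcs (cliques n s)" by (simp add: arcs_cliques)
qed

lemma div_Suc_block: "{u. u div Suc D = k} = {k * Suc D..<k * Suc D + Suc D}"
proof safe
  fix u
  show "u \<in> {u div Suc D * Suc D..<u div Suc D * Suc D + Suc D}"
    using div_times_less_eq_dividend[of u "Suc D"] dividend_less_div_times[of "Suc D" u] by auto
  show "u div Suc D = k" if "u \<in> {k * Suc D..<k * Suc D + Suc D}"
    using that by (intro div_nat_eqI) (auto simp: algebra_simps)
qed

lemma block_remove: "card ({u. u div Suc D = v div Suc D} - {v}) = D"
proof -
  have "card ({u. u div Suc D = v div Suc D} - {v}) = card {u. u div Suc D = v div Suc D} - 1"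
    by (rule card_Diff_singleton) simp
  then show ?thesis by (simp add: div_Suc_block)
qed

lemma length_cliques_card:
  "v < n \<Longrightarrow> length (cliques n s v) = card ({u. u div s = v div s} \<inter> {..<n} - {v})"
proof -
  assume "v < n"
  then have "set (cliques n s v) = {u. u div s = v div s} \<inter> {..<n} - {v}"
    by (auto simp: cliques_def)
  then show ?thesis
    using distinct_card[of "cliques n s v"] adj_valid_distinct[OF adj_valid_cliques] by metis
qed

lemma length_cliques_le: "length (cliques n (Suc D) v) \<le> D"
proof (cases "v < n")
  case True
  have "card ({u. u div Suc D = v div Suc D} \<inter> {..<n} - {v}) \<le> card ({u. u div Suc D = v div Suc D} - {v})"
    by (intro card_mono) (auto simp: div_Suc_block)
  with True show ?thesis by (simp only: length_cliques_card block_remove)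
qed (simp add: cliques_def)

text \<open>The block of \<open>v\<close> starts at or before \<open>v\<close>, so under the
  hypothesis it is not cut off at \<open>n\<close>.\<close>

lemma length_cliques_eq:
  assumes "v + Suc D \<le> n"
  shows "length (cliques n (Suc D) v) = D"
proof -
  have "u < n" if "u div Suc D = v div Suc D" for u
    using dividend_less_div_times[of "Suc D" u] div_times_less_eq_dividend[of v "Suc D"] that assms by auto
  then have "{u. u div Suc D = v div Suc D} \<inter> {..<n} - {v} = {u. u div Suc D = v div Suc D} - {v}"
    by blast
  with assms show ?thesis by (simp only: length_cliques_card block_remove)
qed

abbreviation hard_graphs :: "nat \<Rightarrow> nat \<Rightarrow> (nat \<Rightarrow> nat list) set" where
  "hard_graphs n D \<equiv> graphs n (\<lambda>v. length (cliques n (Suc D) v))"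

lemma max_deg_hard_graphs:
  assumes "L \<in> hard_graphs n D" "Suc D \<le> n"
  shows "max_deg n L = D"
proof -
  have "length (L v) \<le> D" for v
    using assms(1) length_cliques_le by (simp add: graphs_def)
  moreover have "length (L 0) = D"
    using assms length_cliques_eq[of 0 D n] by (simp add: graphs_def)
  moreover have "0 \<in> {..<n}" using assms(2) by simp
  ultimately show ?thesis
    unfolding max_deg_def by (intro Max_eqI) (force intro: rev_image_eqI)+
qed

text \<open>Only the last \<open>Suc D\<close> vertices, which may lie in the incomplete block, are
  discarded from the degree sum.\<close>

lemma card_arcs_hard_graphs:
  assumes "L \<in> hard_graphs n D" "Suc D \<le> n"
  shows "(n - Suc D) * D \<le> card (arcs L)"
proof -
  have "(n - Suc D) * D = (\<Sum>v<n - Suc D. length (L v))"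
    using assms length_cliques_eq by (simp add: graphs_def)
  also have "\<dots> \<le> (\<Sum>v<n. length (L v))" by (intro sum_mono2) auto
  also have "\<dots> = card (arcs L)" using assms card_arcs by (auto simp: graphs_def)
  finally show ?thesis .
qed

section \<open>Numerical estimates and the bound for decision trees\<close>

text \<open>The error term \<open>(2n + 4q + nD) D\<^sup>2\<close> is at most \<open>n\<^sup>2 D / (64c)\<close>, half of the main term
  \<open>(nD/4)\<^sup>2 / (2cD)\<close>.\<close>

lemma switch_count_estimate:
  fixes c D n r q K h :: real
  assumes c: "c > 1" and D: "D \<ge> 1" and n: "384 * c * D\<^sup>2 \<le> n" and r: "r \<ge> 0" "r\<^sup>2 = n"
    and q: "512 * c * q \<le> n * r" and K: "K \<le> 2 * c * D"
    and h: "h \<ge> 0" "q \<ge> 0"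
    and le: "(n * D / 4)\<^sup>2 \<le> K * (h + (2 * n + 4 * q + n * D) * D\<^sup>2)"
  shows "4 * n * D \<le> h"
proof -
  let ?B = "(2 * n + 4 * q + n * D) * D\<^sup>2"
  have n0: "n \<ge> 0" using r(2) by auto
  have D2: "1 \<le> D\<^sup>2" using D by (simp add: one_le_power)
  have "1 * D\<^sup>2 \<le> (384 * c) * D\<^sup>2" using c by (intro mult_right_mono) auto
  then have "D\<^sup>2 \<le> r\<^sup>2" using n r(2) by simp
  then have Dr: "D \<le> r" using r(1) by (rule power2_le_imp_le)
  \<comment> \<open>The query part of the error: 512 = 128 * 4, and \<open>D\<close> is at most the
    square root \<open>r\<close> of \<open>n\<close>.\<close>
  have "128 * c * (4 * q * D\<^sup>2) = (512 * c * q) * D\<^sup>2" by simp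
  also have "\<dots> \<le> (n * r) * D\<^sup>2" by (intro mult_right_mono q) simp
  also have "\<dots> = (n * r * D) * D" by (simp add: power2_eq_square)
  also have "\<dots> \<le> (n * r * D) * r" using n0 r D Dr by (intro mult_left_mono) auto
  also have "\<dots> = n * D * r\<^sup>2" by (simp add: power2_eq_square)
  finally have 1: "128 * c * (4 * q * D\<^sup>2) \<le> n\<^sup>2 * D" unfolding r(2) by (simp add: power2_eq_square algebra_simps)
  have "n * 1 \<le> n * D" using n0 D by (intro mult_left_mono) auto
  then have "(2 * n + n * D) * D\<^sup>2 \<le> (3 * n * D) * D\<^sup>2" by (intro mult_right_mono) (auto simp: mult.commute)
  then have "128 * c * ((2 * n + n * D) * D\<^sup>2) \<le> 128 * c * ((3 * n * D) * D\<^sup>2)"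
    using c by (intro mult_left_mono) auto
  \<comment> \<open>The remaining part is at most \<open>3 * n * D * D\<^sup>2\<close>; here 384 =
    128 * 3 matches the lower bound on \<open>n\<close>.\<close>
  also have "\<dots> = (n * D) * (384 * c * D\<^sup>2)" by simp
  also have "\<dots> \<le> (n * D) * n" using n n0 D by (intro mult_left_mono) auto
  finally have 2: "128 * c * ((2 * n + n * D) * D\<^sup>2) \<le> n\<^sup>2 * D"
    by (simp add: power2_eq_square algebra_simps)
  have 3: "64 * c * ?B \<le> n\<^sup>2 * D" using 1 2 by (simp add: algebra_simps)
  have "0 \<le> ?B" using n0 h D by simp
  then have "K * (h + ?B) \<le> (2 * c * D) * (h + ?B)" using K h by (intro mult_right_mono) auto
  with le have "(n * D / 4)\<^sup>2 \<le> (2 * c * D) * (h + ?B)" by (rule order.trans)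
  moreover have "16 * (n * D / 4)\<^sup>2 = D * (n\<^sup>2 * D)" by (simp add: power2_eq_square)
  moreover have "16 * ((2 * c * D) * (h + ?B)) = D * (32 * c * (h + ?B))" by simp
  ultimately have "D * (n\<^sup>2 * D) \<le> D * (32 * c * (h + ?B))" by linarith
  then have "n\<^sup>2 * D \<le> 32 * c * (h + ?B)" using D by simp
  moreover have "32 * c * (h + ?B) = 32 * c * h + 32 * c * ?B" by (rule distrib_left)
  ultimately have 4: "n\<^sup>2 * D \<le> 64 * c * h" using 3 by linarith
  \<comment> \<open>It remains to turn \<open>n\<^sup>2 * D / (64 * c)\<close> into
    \<open>4 * n * D\<close>, for which \<open>n\<close> must be at least
    \<open>256 * c\<close>.\<close>
  have "384 * c * 1 \<le> 384 * c * D\<^sup>2" using c D2 by (intro mult_left_mono) auto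
  then have "256 * c \<le> n" using n c by linarith
  then have "(256 * c) * (n * D) \<le> n * (n * D)" using n0 D by (intro mult_right_mono) auto
  with 4 have "(64 * c) * (4 * n * D) \<le> (64 * c) * h" by (simp add: power2_eq_square algebra_simps)
  then show ?thesis using c by (simp add: mult_ac)
qed

lemma Suc_degree_le:
  fixes c :: real
  assumes "c > 1" "D \<ge> 1" "384 * c * (real D)\<^sup>2 \<le> real n"
  shows "Suc D \<le> n"
proof -
  have "1 * (real D)\<^sup>2 \<le> c * (real D)\<^sup>2" using assms(1) by (intro mult_right_mono) auto
  moreover have "real D * 1 \<le> (real D)\<^sup>2"
    unfolding power2_eq_square using assms(2) by (intro mult_left_mono) auto
  moreover have "real D \<ge> 1" using assms(2) by simp
  ultimately have "real D + 1 \<le> real n" using assms(3) by linarith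
  then show ?thesis by linarith
qed

text \<open>There are at least \<open>n * D / 2\<close> arcs, and at most half as many are seen: the
  upper bound on \<open>n\<close> gives \<open>r \<le> 40 * c * D\<close>, so \<open>q\<close> is at
  most \<open>(40 / 512) * n * D\<close>.\<close>

lemma unseen_arcs_estimate:
  fixes c D n r q m :: real
  assumes c: "c > 1" and D: "D \<ge> 1" and n: "384 * c * D\<^sup>2 \<le> n" "n \<le> 1536 * c * D\<^sup>2"
    and r: "r \<ge> 0" "r\<^sup>2 = n" and q: "512 * c * q \<le> n * r" and m: "(n - (D + 1)) * D \<le> m"
  shows "n * D / 4 \<le> m - 2 * q"
proof -
  have n0: "n \<ge> 0" using r(2) by auto
  have DD: "D \<le> D\<^sup>2" using D by (simp add: power2_eq_square)
  have "384 * D\<^sup>2 \<le> 384 * c * D\<^sup>2" using c by (intro mult_right_mono) auto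
  then have "n / 2 \<le> n - (D + 1)" using n(1) D DD by linarith
  then have "(n / 2) * D \<le> (n - (D + 1)) * D" using D by (intro mult_right_mono) auto
  then have m': "n * D / 2 \<le> m" using m by simp
  have "1 * c \<le> c * c" using c by (intro mult_right_mono) auto
  \<comment> \<open>1600 is the next perfect square above 1536, so that the root can be taken
    exactly.\<close>
  then have "1536 * c \<le> 1600 * (c * c)" using c by linarith
  then have "1536 * c * D\<^sup>2 \<le> 1600 * (c * c) * D\<^sup>2" by (rule mult_right_mono) simp
  also have "\<dots> = (40 * c * D)\<^sup>2" by (simp add: power2_eq_square)
  finally have "r\<^sup>2 \<le> (40 * c * D)\<^sup>2" using n(2) r(2) by linarith
  then have "r \<le> 40 * c * D" by (rule power2_le_imp_le) (use c D in simp)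
  then have "n * r \<le> n * (40 * c * D)" using n0 by (intro mult_left_mono) auto
  with q have "c * (512 * q) \<le> c * (40 * (n * D))" by (simp add: algebra_simps)
  then have "512 * q \<le> 40 * (n * D)" using c by simp
  moreover have "0 \<le> n * D" using n0 D by simp
  ultimately show ?thesis using m' by linarith
qed

text \<open>Every success has at least \<open>4 * (n * D)\<close> hidden switches, which is also the
  bound on the preimages of a failure; cancelling, successes do not outnumber failures.\<close>

lemma success_at_most_half:
  fixes c :: real
  assumes c: "c > 1" and D: "D \<ge> 1" and n: "384 * c * (real D)\<^sup>2 \<le> real n" "real n \<le> 1536 * c * (real D)\<^sup>2"
    and q: "512 * c * real q \<le> real n * sqrt (real n)"
    and T: "\<And>L. L \<in> hard_graphs n D \<Longrightarrow> num_queries T L \<le> q"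
  shows "2 * card {L \<in> hard_graphs n D. proper_coloring n L (alg_output T L) (c * real D)}
      \<le> card (hard_graphs n D)"
proof -
  let ?S = "{L \<in> hard_graphs n D. proper_coloring n L (alg_output T L) (c * real D)}"
  let ?K = "nat \<lceil>c * real D\<rceil>"
  have "1 * 1 \<le> c * real D" using c D by (intro mult_mono) auto
  \<comment> \<open>Rounding up adds less than 1, hence at most \<open>c * D\<close>.\<close>
  then have K: "c * real D \<le> real ?K" "real ?K \<le> 2 * c * real D" by linarith+
  have Dn: "Suc D \<le> n" by (rule Suc_degree_le[OF c D n(1)])
  have r: "sqrt (real n) \<ge> 0" "(sqrt (real n))\<^sup>2 = real n" by auto
  have D1: "real D \<ge> 1" using D by simp
  have "4 * (n * D) \<le> card (hidden_switches T L)" if "L \<in> ?S" for L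
  proof -
    have L: "L \<in> hard_graphs n D" "adj_valid n L" "proper_coloring n L (alg_output T L) (c * real D)"
      "\<And>v. length (L v) \<le> D"
      using that length_cliques_le by (auto simp: graphs_def)
    have "(real n - (real D + 1)) * real D = real ((n - Suc D) * D)"
      using Dn by (simp add: of_nat_diff)
    also have "\<dots> \<le> real (card (arcs L))"
      using card_arcs_hard_graphs[OF L(1) Dn] by (simp only: of_nat_le_iff)
    finally have "real n * real D / 4 \<le> real (card (arcs L)) - 2 * real q"
      using unseen_arcs_estimate[OF c D1 n r q] by blast
    then have "real n * real D / 4 \<le> real (card (arcs L) - 2 * q)" by linarith
    then have "(real n * real D / 4)\<^sup>2 \<le> (real (card (arcs L) - 2 * q))\<^sup>2"
      by (intro power_mono) auto
    also have "\<dots> = real ((card (arcs L) - 2 * q)\<^sup>2)" by simp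
    also have "\<dots> \<le> real (?K * (card (hidden_switches T L) + (2 * n + 4 * q + n * D) * D\<^sup>2))"
      using hidden_switches_lower_bound[OF L(2,4,3) K(1) T[OF L(1)]] by (simp only: of_nat_le_iff)
    finally have "4 * real n * real D \<le> real (card (hidden_switches T L))"
      by (intro switch_count_estimate[OF c D1 n(1) r q K(2)]) simp_all
    then have "real (4 * (n * D)) \<le> real (card (hidden_switches T L))" by simp
    then show ?thesis by (simp only: of_nat_le_iff)
  qed
  then have "card ?S * (4 * (n * D)) \<le> card (hard_graphs n D - ?S) * (4 * (n * D))"
    by (intro success_card_bound length_cliques_le)
  moreover have "0 < 4 * (n * D)" using D Dn by simp
  ultimately have "card ?S \<le> card (hard_graphs n D - ?S)" by (simp only: mult_le_cancel2)
  moreover have "card (hard_graphs n D - ?S) = card (hard_graphs n D) - card ?S"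
    by (rule card_Diff_subset) (auto simp: finite_graphs)
  ultimately show ?thesis by linarith
qed

section \<open>From decision trees to randomized algorithms\<close>

text \<open>The easy direction of Yao's principle: the expected number of inputs in
  \<open>\<Omega>\<close> on which the random tree succeeds is at least
  \<open>p * card \<Omega>\<close> and at most \<open>r * card \<Omega>\<close>.\<close>

lemma average_success_probability:
  fixes A :: "'t pmf" and p r :: real
  assumes "finite \<Omega>" "\<Omega> \<noteq> {}"
    and p: "\<And>L. L \<in> \<Omega> \<Longrightarrow> p \<le> measure_pmf.prob A {T. P L T}"
    and r: "\<And>T. T \<in> set_pmf A \<Longrightarrow> real (card {L \<in> \<Omega>. P L T}) \<le> r * real (card \<Omega>)"
  shows "p \<le> r"
proof -
  let ?f = "\<lambda>L. indicat_real {T. P L T}"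
  have int: "integrable (measure_pmf A) (?f L)" for L
    by (rule measure_pmf.integrable_const_bound[where B = 1]) auto
  have sum: "(\<Sum>L\<in>\<Omega>. ?f L T) = real (card {L \<in> \<Omega>. P L T})" for T
    using assms(1) by (simp add: indicator_def sum.If_cases Int_def)
  have "p * real (card \<Omega>) \<le> (\<Sum>L\<in>\<Omega>. measure_pmf.prob A {T. P L T})"
    using sum_bounded_below[of \<Omega> p "\<lambda>L. measure_pmf.prob A {T. P L T}"] p by (simp add: mult.commute)
  also have "\<dots> = measure_pmf.expectation A (\<lambda>T. \<Sum>L\<in>\<Omega>. ?f L T)"
    using int by (subst Bochner_Integration.integral_sum) auto
  also have "\<dots> \<le> r * real (card \<Omega>)"
    using r int by (intro measure_pmf.integral_le_const Bochner_Integration.integrable_sum)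
      (auto simp: AE_measure_pmf_iff sum)
  finally show ?thesis using assms(1,2) by (simp add: card_gt_0_iff)
qed

theorem mainTheorem11:
  fixes c :: real
  assumes "c > 1"
  shows "\<exists>p0 < (1::real). \<exists>\<epsilon> > (0::real). \<exists>N. \<forall>n \<ge> N. \<forall>(A :: ralg) (q :: nat).
           (\<forall>L. adj_valid n L \<and> max_deg n L \<ge> 1 \<longrightarrow>
              measure_pmf.prob A
                {T. proper_coloring n L (alg_output T L) (c * real (max_deg n L))} \<ge> p0) \<longrightarrow>
           (\<forall>L. adj_valid n L \<longrightarrow> (\<forall>T \<in> set_pmf A. num_queries T L \<le> q)) \<longrightarrow>
           real q \<ge> \<epsilon> * real n * sqrt (real n)"
proof (intro exI conjI allI impI)
  \<comment> \<open>Any success probability above 1/2 contradicts the bound for decision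
    trees.\<close>
  show "3 / 4 < (1::real)" by simp
  show "1 / (512 * c) > 0" using assms by simp
  fix n :: nat and A :: ralg and q :: nat
  assume N: "nat \<lceil>384 * c\<rceil> \<le> n"
    and p: "\<forall>L. adj_valid n L \<and> max_deg n L \<ge> 1 \<longrightarrow>
              measure_pmf.prob A
                {T. proper_coloring n L (alg_output T L) (c * real (max_deg n L))} \<ge> 3 / 4"
    and q: "\<forall>L. adj_valid n L \<longrightarrow> (\<forall>T \<in> set_pmf A. num_queries T L \<le> q)"
  \<comment> \<open>\<open>D\<close> is the largest integer with
    \<open>384 * c * D\<^sup>2 \<le> n\<close>, and the choice of \<open>N\<close> makes it at least
    1. As \<open>t \<ge> 1\<close>, rounding down loses at most a factor 2, whence 1536 = 4 * 384 in
    the upper bound on \<open>n\<close>.\<close>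
  define t where "t = sqrt (real n / (384 * c))"
  define D where "D = nat \<lfloor>t\<rfloor>"
  have c: "c > 0" using assms by simp
  have "384 * c \<le> real n" using N by linarith
  then have "t \<ge> 1" using c by (simp add: t_def)
  then have D: "D \<ge> 1" "real D \<le> t" "t < real D + 1"
    unfolding D_def by linarith+
  then have D2: "t \<le> 2 * real D" by linarith
  have t2: "384 * c * t\<^sup>2 = real n" using c by (simp add: t_def)
  have "384 * c * (real D)\<^sup>2 \<le> 384 * c * t\<^sup>2"
    using c D by (intro mult_left_mono power_mono) auto
  then have n1: "384 * c * (real D)\<^sup>2 \<le> real n" by (simp only: t2)
  have "384 * c * t\<^sup>2 \<le> 384 * c * (2 * real D)\<^sup>2"
    using c D2 \<open>t \<ge> 1\<close> by (intro mult_left_mono power_mono) auto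
  then have n2: "real n \<le> 1536 * c * (real D)\<^sup>2" unfolding t2 by (simp add: power_mult_distrib)
  have Dn: "Suc D \<le> n" by (rule Suc_degree_le[OF assms D(1) n1])
  show "real q \<ge> 1 / (512 * c) * real n * sqrt (real n)"
  proof (rule ccontr)
    assume "\<not> real q \<ge> 1 / (512 * c) * real n * sqrt (real n)"
    then have q': "512 * c * real q \<le> real n * sqrt (real n)"
      using c by (simp add: field_simps)
    have "cliques n (Suc D) \<in> hard_graphs n D"
      by (simp add: graphs_def adj_valid_cliques)
    then have ne: "hard_graphs n D \<noteq> {}" by blast
    have "3 / 4 \<le> (1 / 2 :: real)"
    proof (rule average_success_probability[OF finite_graphs ne])
      fix L assume L: "L \<in> hard_graphs n D"
      then have "adj_valid n L" by (simp add: graphs_def)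
      then show "3 / 4 \<le> measure_pmf.prob A {T. proper_coloring n L (alg_output T L) (c * real D)}"
        using p max_deg_hard_graphs[OF L Dn] D(1) by metis
    next
      fix T assume "T \<in> set_pmf A"
      then have "num_queries T L \<le> q" if "L \<in> hard_graphs n D" for L
        using q that by (simp add: graphs_def)
      then have "2 * card {L \<in> hard_graphs n D. proper_coloring n L (alg_output T L) (c * real D)}
          \<le> card (hard_graphs n D)"
        by (intro success_at_most_half[OF assms D(1) n1 n2 q'])
      then show "real (card {L \<in> hard_graphs n D. proper_coloring n L (alg_output T L) (c * real D)})
          \<le> 1 / 2 * real (card (hard_graphs n D))"
        by linarith
    qed
    then show False by simp
  qed
qed

end
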